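(* There exist 2-qBMGs on five vertices whose underlying undirected graph is not $P_5$-free. More precisely, up to isomorphism there are exactly six 2-qBMGs on the vertex set $\{v_1,v_2,v_3,v_4,v_5\}$ whose underlying undirected graph is the path graph $v_1v_2v_3v_4v_5$ (with edges exactly $\{v_i,v_{i+1}\}$, $1\le i\le 4$), namely those with edge sets $\{v_1v_2,v_3v_2,v_3v_4,v_4v_5\}$, $\{v_1v_2,v_3v_2,v_3v_4,v_5v_4\}$, $\{v_2v_1,v_3v_2,v_3v_4,v_4v_5\}$, $\{v_1v_2,v_2v_1,v_3v_2,v_3v_4,v_4v_5\}$, $\{v_1v_2,v_2v_1,v_3v_2,v_3v_4,v_5v_4\}$, $\{v_1v_2,v_2v_1,v_3v_2,v_3v_4,v_4v_5,v_5v_4\}$ (where $xy$ denotes the directed edge from $x$ to $y$).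
   Context: A two-color quasi best match graph (2-qBMG) is a bipartite directed graph $\overrightarrow{G}$ (vertex set split into two color classes, every edge joining vertices of different colors) without loops and parallel edges, satisfying: (N1) if $u$ and $v$ are two independent (non-adjacent) vertices then there exist no vertices $w,t$ such that $ut, vw, tw$ are edges; (N2) if $uv, vw, wt$ are edges then $ut$ is an edge; (N3) if $u$ and $v$ have a common out-neighbor then either every out-neighbor of $u$ is an out-neighbor of $v$ or every out-neighbor of $v$ is an out-neighbor of $u$. The underlying undirected graph of a digraph has the same vertex set and an undirected edge $\{u,v\}$ whenever $uv$ or $vu$ is a directed edge. A graph is $P_5$-free if it has no induced subgraph isomorphic to the path graph on five vertices. Two digraphs on the same vertex set $V$ are isomorphic if some permutation $\varphi$ of $V$ satisfies: $xy$ is an edge of the first iff $\varphi(x)\varphi(y)$ is an edge of the second. *)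

theory Defs
  imports "Graph_Theory.Pair_Digraph" "HOL-Combinatorics.Permutations"
begin

text \<open>
  Arcs of a \<^type>\<open>pair_pre_digraph\<close> form a set of ordered pairs, so parallel edges are excluded
  by construction; a pair of opposite edges \<open>uv\<close>, \<open>vu\<close> is allowed.
\<close>

locale two_qBMG = pair_loopfree_digraph G for G :: "'a pair_pre_digraph" +
  assumes bipartite:
    "\<exists>A B. A \<union> B = pverts G \<and> A \<inter> B = {} \<and>
       (\<forall>(x, y) \<in> parcs G. x \<in> A \<and> y \<in> B \<or> x \<in> B \<and> y \<in> A)"
  and N1:
    "\<lbrakk>u \<in> pverts G; v \<in> pverts G; u \<noteq> v; (u, v) \<notin> parcs G; (v, u) \<notin> parcs G\<rbrakk>
      \<Longrightarrow> \<not> (\<exists>w t. (u, t) \<in> parcs G \<and> (v, w) \<in> parcs G \<and> (t, w) \<in> parcs G)"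
  and N2:
    "\<lbrakk>(u, v) \<in> parcs G; (v, w) \<in> parcs G; (w, t) \<in> parcs G\<rbrakk> \<Longrightarrow> (u, t) \<in> parcs G"
  and N3:
    "\<exists>x. (u, x) \<in> parcs G \<and> (v, x) \<in> parcs G
      \<Longrightarrow> (\<forall>y. (u, y) \<in> parcs G \<longrightarrow> (v, y) \<in> parcs G) \<or>
          (\<forall>y. (v, y) \<in> parcs G \<longrightarrow> (u, y) \<in> parcs G)"

text \<open>
  Undirected graphs are pairs of a vertex set and a set of two-element sets of vertices.
\<close>

type_synonym 'a undirected_graph = "'a set \<times> 'a set set"

definition underlying_graph :: "'a pair_pre_digraph \<Rightarrow> 'a undirected_graph" where
  "underlying_graph G = (pverts G, {{u, v} | u v. (u, v) \<in> parcs G \<or> (v, u) \<in> parcs G})"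

definition undirected_isomorphic :: "'a undirected_graph \<Rightarrow> 'b undirected_graph \<Rightarrow> bool" where
  "undirected_isomorphic X Y \<longleftrightarrow>
    (\<exists>f. bij_betw f (fst X) (fst Y) \<and>
      (\<forall>x \<in> fst X. \<forall>y \<in> fst X. {x, y} \<in> snd X \<longleftrightarrow> {f x, f y} \<in> snd Y))"

definition induced_undirected :: "'a undirected_graph \<Rightarrow> 'a set \<Rightarrow> 'a undirected_graph" where
  "induced_undirected X W = (W, {e \<in> snd X. e \<subseteq> W})"

definition path_graph :: "nat \<Rightarrow> nat undirected_graph" where
  "path_graph n = ({1..n}, {{i, Suc i} | i. 1 \<le> i \<and> Suc i \<le> n})"

definition P5_free :: "'a undirected_graph \<Rightarrow> bool" where
  "P5_free X \<longleftrightarrow>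
    \<not> (\<exists>W \<subseteq> fst X. undirected_isomorphic (induced_undirected X W) (path_graph 5))"

text \<open>
  Isomorphism of two digraphs on a common vertex set, via a permutation of that set.
\<close>

definition digraph_isomorphic :: "'a pair_pre_digraph \<Rightarrow> 'a pair_pre_digraph \<Rightarrow> bool" where
  "digraph_isomorphic G H \<longleftrightarrow>
    pverts G = pverts H \<and>
    (\<exists>\<phi>. \<phi> permutes pverts G \<and>
      (\<forall>x \<in> pverts G. \<forall>y \<in> pverts G. (x, y) \<in> parcs G \<longleftrightarrow> (\<phi> x, \<phi> y) \<in> parcs H))"

end

theory Submission
  imports Defs
begin

text \<open>
  On the path, (N1) and (N2) forbid a directed walk through \<open>v3\<close>, and (N1) and (N3) forbid \<open>v3\<close>
  from being a sink. Hence \<open>v3v2\<close> and \<open>v3v4\<close> are one-way edges, while each of the two end edges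
  may be oriented in any of three ways; all nine resulting digraphs are 2-qBMGs. As \<open>v3\<close> is the
  only vertex with two out-neighbours, every isomorphism between them fixes it and so is the
  identity or the reversal of the path. The isomorphism classes are therefore the six unordered
  pairs of orientations of the end edges.
\<close>

section \<open>Isomorphism as an equivalence relation, and counting its classes by a
  transversal\<close>

lemma digraph_isomorphic_refl: "digraph_isomorphic G G"
  unfolding digraph_isomorphic_def by (auto intro!: exI[of _ id] permutes_id)

lemma digraph_isomorphic_sym:
  assumes "digraph_isomorphic G H"
  shows "digraph_isomorphic H G"
proof -
  from assms obtain \<phi> where V: "pverts G = pverts H" and p: "\<phi> permutes pverts G"
    and E: "\<And>x y. x \<in> pverts G \<Longrightarrow> y \<in> pverts G \<Longrightarrow>
      (x, y) \<in> parcs G \<longleftrightarrow> (\<phi> x, \<phi> y) \<in> parcs H"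
    unfolding digraph_isomorphic_def by blast
  have "(x, y) \<in> parcs H \<longleftrightarrow> (inv \<phi> x, inv \<phi> y) \<in> parcs G"
    if "x \<in> pverts G" "y \<in> pverts G" for x y
    using E[of "inv \<phi> x" "inv \<phi> y"] that
    by (simp add: permutes_in_image[OF permutes_inv[OF p]] permutes_inverses(1)[OF p])
  with V permutes_inv[OF p] show ?thesis
    unfolding digraph_isomorphic_def by metis
qed

lemma digraph_isomorphic_trans:
  assumes "digraph_isomorphic G H" "digraph_isomorphic H K"
  shows "digraph_isomorphic G K"
proof -
  from assms(1) obtain \<phi> where V: "pverts G = pverts H" and p: "\<phi> permutes pverts G"
    and E: "\<And>x y. x \<in> pverts G \<Longrightarrow> y \<in> pverts G \<Longrightarrow>
      (x, y) \<in> parcs G \<longleftrightarrow> (\<phi> x, \<phi> y) \<in> parcs H"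
    unfolding digraph_isomorphic_def by blast
  from assms(2) obtain \<psi> where V': "pverts H = pverts K" and p': "\<psi> permutes pverts H"
    and E': "\<And>x y. x \<in> pverts H \<Longrightarrow> y \<in> pverts H \<Longrightarrow>
      (x, y) \<in> parcs H \<longleftrightarrow> (\<psi> x, \<psi> y) \<in> parcs K"
    unfolding digraph_isomorphic_def by blast
  have "\<psi> \<circ> \<phi> permutes pverts G"
    using permutes_compose[OF p] p' V by simp
  moreover have "(x, y) \<in> parcs G \<longleftrightarrow> ((\<psi> \<circ> \<phi>) x, (\<psi> \<circ> \<phi>) y) \<in> parcs K"
    if "x \<in> pverts G" "y \<in> pverts G" for x y
    using that E E' V permutes_in_image[OF p] by simp
  ultimately show ?thesis
    using V V' unfolding digraph_isomorphic_def by metis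
qed

lemma equiv_digraph_isomorphic:
  "equiv S {(G, H). G \<in> S \<and> H \<in> S \<and> digraph_isomorphic G H}"
  by (rule equivI)
    (auto simp: refl_on_def sym_def trans_def intro: digraph_isomorphic_refl
      digraph_isomorphic_sym digraph_isomorphic_trans)

text \<open>Sending a representative to its class is a bijection from \<open>L\<close> onto the
  quotient: uniqueness in \<open>ex1\<close> gives injectivity, existence gives
  surjectivity.\<close>

lemma card_quotient_transversal:
  assumes "equiv S R" "L \<subseteq> S" and ex1: "\<And>x. x \<in> S \<Longrightarrow> \<exists>!y. y \<in> L \<and> (x, y) \<in> R"
  shows "card (S // R) = card L"
proof -
  have "bij_betw (\<lambda>y. R `` {y}) L (S // R)"
  proof (rule bij_betw_imageI)
    show "inj_on (\<lambda>y. R `` {y}) L"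
    proof (rule inj_onI)
      fix x y assume xy: "x \<in> L" "y \<in> L" "R `` {x} = R `` {y}"
      with assms(2) have "(x, y) \<in> R" "(x, x) \<in> R"
        using eq_equiv_class_iff[OF assms(1)] by blast+
      with xy assms(2) ex1[of x] show "x = y" by blast
    qed
    show "(\<lambda>y. R `` {y}) ` L = S // R"
    proof
      show "(\<lambda>y. R `` {y}) ` L \<subseteq> S // R"
        using assms(2) by (auto intro: quotientI)
      show "S // R \<subseteq> (\<lambda>y. R `` {y}) ` L"
      proof
        fix X assume "X \<in> S // R"
        then obtain x where x: "x \<in> S" "X = R `` {x}" by (rule quotientE)
        with ex1 obtain y where "y \<in> L" "(x, y) \<in> R" by blast
        with x equiv_class_eq[OF assms(1)] show "X \<in> (\<lambda>y. R `` {y}) ` L" by blast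
      qed
    qed
  qed
  then show ?thesis by (simp add: bij_betw_same_card)
qed

lemma card_isomorphism_classes_transversal:
  assumes "L \<subseteq> S" and ex1: "\<And>G. G \<in> S \<Longrightarrow> \<exists>!H. H \<in> L \<and> digraph_isomorphic G H"
  shows "card (S // {(G, H). G \<in> S \<and> H \<in> S \<and> digraph_isomorphic G H}) = card L"
proof (rule card_quotient_transversal[OF equiv_digraph_isomorphic assms(1)])
  fix G assume "G \<in> S"
  with ex1[of G] assms(1)
  show "\<exists>!H. H \<in> L \<and> (G, H) \<in> {(G, H). G \<in> S \<and> H \<in> S \<and> digraph_isomorphic G H}"
    by blast
qed

section \<open>The five-vertex path and its orientations\<close>

locale five_path =
  fixes v1 v2 v3 v4 v5 :: 'a
  assumes distinct: "distinct [v1, v2, v3, v4, v5]"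
begin

lemma neqs [simp]:
  "v1 \<noteq> v2" "v1 \<noteq> v3" "v1 \<noteq> v4" "v1 \<noteq> v5" "v2 \<noteq> v1" "v2 \<noteq> v3" "v2 \<noteq> v4" "v2 \<noteq> v5"
  "v3 \<noteq> v1" "v3 \<noteq> v2" "v3 \<noteq> v4" "v3 \<noteq> v5" "v4 \<noteq> v1" "v4 \<noteq> v2" "v4 \<noteq> v3" "v4 \<noteq> v5"
  "v5 \<noteq> v1" "v5 \<noteq> v2" "v5 \<noteq> v3" "v5 \<noteq> v4"
  using distinct by auto

abbreviation V where "V \<equiv> {v1, v2, v3, v4, v5}"

abbreviation P where "P \<equiv> (V, {{v1, v2}, {v2, v3}, {v3, v4}, {v4, v5}})"

lemma path_not_P5_free: "\<not> P5_free P"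
proof -
  \<comment> \<open>The default value 5 is the image of \<open>v5\<close>. The witness for the
    induced subgraph is all of \<open>V\<close>, since \<open>P\<close> is itself a path on five
    vertices.\<close>
  let ?f = "(\<lambda>_. 5 :: nat)(v1 := 1, v2 := 2, v3 := 3, v4 := 4)"
  have I: "{1..5} = {1, 2, 3, 4, 5 :: nat}" by auto
  have E: "{{i, Suc i} | i. 1 \<le> i \<and> Suc i \<le> 5} = {{1, 2}, {2, 3}, {3, 4}, {4, 5}}"
  proof -
    have "(1 \<le> i \<and> Suc i \<le> 5) \<longleftrightarrow> i = 1 \<or> i = 2 \<or> i = 3 \<or> i = 4" for i by auto
    then show ?thesis by (auto simp: numeral_eq_Suc)
  qed
  have "bij_betw ?f V {1, 2, 3, 4, 5}"
    by (auto simp: bij_betw_def inj_on_def)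
  then have "undirected_isomorphic (induced_undirected P V) (path_graph 5)"
    unfolding undirected_isomorphic_def induced_undirected_def path_graph_def I E
    by (intro exI[of _ ?f]) (auto simp: doubleton_eq_iff)
  then show ?thesis unfolding P5_free_def by auto
qed

text \<open>
  The flags of \<open>l\<close> record the presence of \<open>v1v2\<close> and \<open>v2v1\<close>, those of \<open>r\<close> the presence of
  \<open>v5v4\<close> and \<open>v4v5\<close>; reversing the path exchanges \<open>l\<close> and \<open>r\<close>.
\<close>

definition orientation :: "bool \<times> bool \<Rightarrow> bool \<times> bool \<Rightarrow> 'a pair_pre_digraph" where
  "orientation l r = \<lparr>pverts = V, parcs = {(v3, v2), (v3, v4)} \<union>
    (if fst l then {(v1, v2)} else {}) \<union> (if snd l then {(v2, v1)} else {}) \<union>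
    (if fst r then {(v5, v4)} else {}) \<union> (if snd r then {(v4, v5)} else {})\<rparr>"

text \<open>The three ways to orient an end edge; \<open>(False, False)\<close> is left out because
  it would delete that edge from the underlying graph.\<close>

definition flags :: "(bool \<times> bool) set" where
  "flags = {(True, False), (False, True), (True, True)}"

lemma pverts_orientation [simp]: "pverts (orientation l r) = V"
  by (simp add: orientation_def)

lemma parcs_orientation:
  "(x, y) \<in> parcs (orientation l r) \<longleftrightarrow>
    x = v3 \<and> y = v2 \<or> x = v3 \<and> y = v4 \<or> fst l \<and> x = v1 \<and> y = v2 \<or> snd l \<and> x = v2 \<and> y = v1 \<or>
    fst r \<and> x = v5 \<and> y = v4 \<or> snd r \<and> x = v4 \<and> y = v5"
  by (auto simp: orientation_def)

text \<open>Each flag is the membership of one end arc, so the arc set determines all four flags.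
  This is what makes the six listed digraphs pairwise distinct.\<close>

lemma orientation_inject [simp]:
  "orientation l r = orientation l' r' \<longleftrightarrow> l = l' \<and> r = r'"
proof
  assume "orientation l r = orientation l' r'"
  then have "(x, y) \<in> parcs (orientation l r) \<longleftrightarrow> (x, y) \<in> parcs (orientation l' r')" for x y
    by simp
  from this[of v1 v2] this[of v2 v1] this[of v4 v5] this[of v5 v4]
  show "l = l' \<and> r = r'" by (simp add: parcs_orientation prod_eq_iff)
qed simp

lemma underlying_orientation:
  assumes "l \<in> flags" "r \<in> flags"
  shows "underlying_graph (orientation l r) = P"
proof -
  let ?E = "parcs (orientation l r)"
  have "(v1, v2) \<in> ?E \<or> (v2, v1) \<in> ?E" "(v3, v2) \<in> ?E" "(v3, v4) \<in> ?E"
    "(v4, v5) \<in> ?E \<or> (v5, v4) \<in> ?E"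
    using assms by (auto simp: flags_def parcs_orientation)
  then have "{{v1, v2}, {v2, v3}, {v3, v4}, {v4, v5}} \<subseteq>
      {{u, v} | u v. (u, v) \<in> ?E \<or> (v, u) \<in> ?E}"
    by blast
  moreover have "{{u, v} | u v. (u, v) \<in> ?E \<or> (v, u) \<in> ?E} \<subseteq>
      {{v1, v2}, {v2, v3}, {v3, v4}, {v4, v5}}"
    by (auto simp: parcs_orientation)
  ultimately show ?thesis
    unfolding underlying_graph_def pverts_orientation
    by (intro arg_cong2[of _ _ _ _ Pair] refl antisym)
qed

text \<open>No arc enters \<open>v3\<close>, so a walk can only leave it: it stays on one side of
  the path and can continue only by going back and forth along an end edge. Both (N1) and (N2) are
  checked on this short list.\<close>

lemma orientation_two_step:
  assumes "(x, y) \<in> parcs (orientation l r)" "(y, z) \<in> parcs (orientation l r)"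
  shows "(x, y, z) \<in> {(v3, v2, v1), (v3, v4, v5),
    (v1, v2, v1), (v2, v1, v2), (v5, v4, v5), (v4, v5, v4)}"
  using assms unfolding parcs_orientation by (elim disjE conjE; simp)

lemma two_qBMG_orientation: "two_qBMG (orientation l r)"
proof unfold_locales
  show "\<exists>A B. A \<union> B = pverts (orientation l r) \<and> A \<inter> B = {} \<and>
      (\<forall>(x, y) \<in> parcs (orientation l r). x \<in> A \<and> y \<in> B \<or> x \<in> B \<and> y \<in> A)"
    by (rule exI[of _ "{v1, v3, v5}"], rule exI[of _ "{v2, v4}"])
      (auto simp: parcs_orientation)
next
  fix u v
  assume indep: "(u, v) \<notin> parcs (orientation l r)" "(v, u) \<notin> parcs (orientation l r)"
  show "\<not> (\<exists>w t. (u, t) \<in> parcs (orientation l r) \<and>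
      (v, w) \<in> parcs (orientation l r) \<and> (t, w) \<in> parcs (orientation l r))"
  proof clarify
    fix w t
    assume arcs: "(u, t) \<in> parcs (orientation l r)" "(v, w) \<in> parcs (orientation l r)"
      "(t, w) \<in> parcs (orientation l r)"
    \<comment> \<open>Besides \<open>t\<close>, only \<open>v3\<close> can have an arc to the
      endpoint \<open>w\<close>, and then the walk starts and ends at \<open>v2\<close> or
      \<open>v4\<close>. In either case \<open>u\<close> and \<open>v\<close> are adjacent.\<close>
    from orientation_two_step[OF arcs(1,3)] arcs(2)
    have "v = t \<or> v = v3 \<and> (u = v2 \<or> u = v4)"
      unfolding parcs_orientation by (elim insertE emptyE disjE conjE; simp)
    with arcs(1) indep show False
      by (elim disjE conjE) (simp_all add: parcs_orientation)
  qed
next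
  fix u v w t
  assume arcs: "(u, v) \<in> parcs (orientation l r)" "(v, w) \<in> parcs (orientation l r)"
    "(w, t) \<in> parcs (orientation l r)"
  \<comment> \<open>The vertex \<open>v\<close> has an incoming arc, so it is not \<open>v3\<close>,
    and the walk \<open>v\<close>, \<open>w\<close>, \<open>t\<close> goes back and forth. Thus
    \<open>t\<close> equals \<open>v\<close> and the required arc is the first one.\<close>
  from orientation_two_step[OF arcs(1,2)] orientation_two_step[OF arcs(2,3)] arcs
  show "(u, t) \<in> parcs (orientation l r)"
    by auto
next
  fix u v
  assume "\<exists>x. (u, x) \<in> parcs (orientation l r) \<and> (v, x) \<in> parcs (orientation l r)"
  \<comment> \<open>Distinct vertices share an out-neighbour only if one is \<open>v3\<close> and
    the other an end vertex, whose single out-neighbour is also one of \<open>v3\<close>.\<close>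
  then have "u = v \<or> u = v3 \<and> (v = v1 \<or> v = v5) \<or> v = v3 \<and> (u = v1 \<or> u = v5)"
    unfolding parcs_orientation by (elim exE disjE conjE; simp)
  then show "(\<forall>y. (u, y) \<in> parcs (orientation l r) \<longrightarrow> (v, y) \<in> parcs (orientation l r)) \<or>
      (\<forall>y. (v, y) \<in> parcs (orientation l r) \<longrightarrow> (u, y) \<in> parcs (orientation l r))"
    by (elim disjE conjE) (simp_all add: parcs_orientation)
qed (auto simp: parcs_orientation)

section \<open>Classification of the 2-qBMGs on the path\<close>

lemma two_qBMG_on_path_cases:
  assumes "two_qBMG G" "underlying_graph G = P"
  obtains l r where "l \<in> flags" "r \<in> flags" "G = orientation l r"
proof -
  interpret two_qBMG G by fact
  have verts: "pverts G = V"
    using assms(2) by (simp add: underlying_graph_def)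
  have adj: "(x, y) \<in> parcs G \<or> (y, x) \<in> parcs G \<longleftrightarrow>
      {x, y} \<in> {{v1, v2}, {v2, v3}, {v3, v4}, {v4, v5}}" for x y
  proof -
    have "{x, y} \<in> snd (underlying_graph G) \<longleftrightarrow> (x, y) \<in> parcs G \<or> (y, x) \<in> parcs G"
      by (auto simp: underlying_graph_def doubleton_eq_iff)
    with assms(2) show ?thesis by simp
  qed
  have e12: "(v1, v2) \<in> parcs G \<or> (v2, v1) \<in> parcs G"
    and e23: "(v2, v3) \<in> parcs G \<or> (v3, v2) \<in> parcs G"
    and e34: "(v3, v4) \<in> parcs G \<or> (v4, v3) \<in> parcs G"
    and e45: "(v4, v5) \<in> parcs G \<or> (v5, v4) \<in> parcs G"
    by (auto simp: adj)
  \<comment> \<open>These are the pairs at distance three on the path; each contradiction below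
    produces an arc between the vertices of one of them.\<close>
  have n14: "(v1, v4) \<notin> parcs G" "(v4, v1) \<notin> parcs G"
    and n25: "(v2, v5) \<notin> parcs G" "(v5, v2) \<notin> parcs G"
    using adj[of v1 v4] adj[of v2 v5] by (auto simp: doubleton_eq_iff)
  have N1': "(u, v) \<in> parcs G \<or> (v, u) \<in> parcs G"
    if "(u, t) \<in> parcs G" "(v, w) \<in> parcs G" "(t, w) \<in> parcs G" "u \<noteq> v" for u v w t
    using N1[of u v] that in_arcsD1 by blast
  \<comment> \<open>If the last edge continues the walk, (N2) yields the arc from \<open>v2\<close>
    to \<open>v5\<close>; if it points back to \<open>v4\<close>, (N1) makes \<open>v2\<close> and
    \<open>v5\<close> adjacent.\<close>
  have no_path_right: False if "(v2, v3) \<in> parcs G" "(v3, v4) \<in> parcs G"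
    using e45
  proof
    assume "(v4, v5) \<in> parcs G"
    with N2[OF that] n25 show False by blast
  next
    assume "(v5, v4) \<in> parcs G"
    with N1'[OF that(1) _ that(2), of v5] n25 show False by simp
  qed
  have no_path_left: False if "(v4, v3) \<in> parcs G" "(v3, v2) \<in> parcs G"
    using e12
  proof
    assume "(v1, v2) \<in> parcs G"
    with N1'[OF that(1) _ that(2), of v1] n14 show False by simp
  next
    assume "(v2, v1) \<in> parcs G"
    with N2[OF that] n14 show False by blast
  qed
  have no_sink: False if "(v2, v3) \<in> parcs G" "(v4, v3) \<in> parcs G"
  proof -
    \<comment> \<open>By (N1) the end edges must point outwards. Then \<open>v2\<close> and
      \<open>v4\<close> share the out-neighbour \<open>v3\<close>, while \<open>v1\<close> and
      \<open>v5\<close> are private to one of them, against (N3).\<close>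
    have "(v1, v2) \<notin> parcs G" "(v5, v4) \<notin> parcs G"
      using N1'[of v1 v2 v4 v3] N1'[of v5 v4 v2 v3] that n14 n25 by auto
    with e12 e45 have "(v2, v1) \<in> parcs G" "(v4, v5) \<in> parcs G" by auto
    with that N3[of v2 v4] n14 n25 show False by blast
  qed
  have out: "(v3, v2) \<in> parcs G" "(v2, v3) \<notin> parcs G" "(v3, v4) \<in> parcs G" "(v4, v3) \<notin> parcs G"
    using e23 e34 no_path_right no_path_left no_sink by blast+
  define l where "l = ((v1, v2) \<in> parcs G, (v2, v1) \<in> parcs G)"
  define r where "r = ((v5, v4) \<in> parcs G, (v4, v5) \<in> parcs G)"
  have "(x, y) \<in> parcs G \<longleftrightarrow> (x, y) \<in> parcs (orientation l r)" for x y
  proof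
    assume xy: "(x, y) \<in> parcs G"
    then have "{x, y} \<in> {{v1, v2}, {v2, v3}, {v3, v4}, {v4, v5}}"
      by (rule adj[THEN iffD1, OF disjI1])
    then have "x = v1 \<and> y = v2 \<or> x = v2 \<and> y = v1 \<or> x = v2 \<and> y = v3 \<or> x = v3 \<and> y = v2 \<or>
        x = v3 \<and> y = v4 \<or> x = v4 \<and> y = v3 \<or> x = v4 \<and> y = v5 \<or> x = v5 \<and> y = v4"
      unfolding insert_iff doubleton_eq_iff by blast
    with xy out show "(x, y) \<in> parcs (orientation l r)"
      by (elim disjE conjE) (simp_all add: parcs_orientation l_def r_def)
  next
    assume "(x, y) \<in> parcs (orientation l r)"
    with out show "(x, y) \<in> parcs G"
      unfolding parcs_orientation by (elim disjE conjE) (simp_all add: l_def r_def)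
  qed
  then have "G = orientation l r"
    using verts by (intro pair_pre_digraph.equality) auto
  moreover have "l \<in> flags" "r \<in> flags"
    using e12 e45 by (auto simp: l_def r_def flags_def)
  ultimately show thesis using that by blast
qed

section \<open>Isomorphisms between orientations\<close>

lemma digraph_isomorphic_orientation_swap:
  "digraph_isomorphic (orientation l r) (orientation r l)"
proof -
  \<comment> \<open>This is the reversal of the path, fixing \<open>v3\<close>.\<close>
  let ?\<phi> = "transpose v1 v5 \<circ> transpose v2 v4"
  have "?\<phi> permutes V"
    by (intro permutes_compose permutes_swap_id) auto
  moreover have "(x, y) \<in> parcs (orientation l r) \<longleftrightarrow> (?\<phi> x, ?\<phi> y) \<in> parcs (orientation r l)"
    if "x \<in> V" "y \<in> V" for x y
    using that by (elim insertE emptyE) (simp_all add: parcs_orientation transpose_def)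
  ultimately show ?thesis
    unfolding digraph_isomorphic_def pverts_orientation by blast
qed

lemma digraph_isomorphic_orientation_cases:
  assumes flags: "l \<in> flags" "r \<in> flags"
    and iso: "digraph_isomorphic (orientation l r) (orientation l' r')"
  shows "l = l' \<and> r = r' \<or> l = r' \<and> r = l'"
proof -
  from iso obtain \<phi> where p: "\<phi> permutes V"
    and "\<forall>x \<in> V. \<forall>y \<in> V.
      (x, y) \<in> parcs (orientation l r) \<longleftrightarrow> (\<phi> x, \<phi> y) \<in> parcs (orientation l' r')"
    unfolding digraph_isomorphic_def pverts_orientation by blast
  then have E: "(x, y) \<in> parcs (orientation l r) \<longleftrightarrow> (\<phi> x, \<phi> y) \<in> parcs (orientation l' r')"
    if "x \<in> V" "y \<in> V" for x y
    using that by blast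
  have inj: "\<phi> x = \<phi> y \<longleftrightarrow> x = y" for x y
    by (rule inj_eq[OF permutes_inj[OF p]])
  have "(v3, v2) \<in> parcs (orientation l r)" "(v3, v4) \<in> parcs (orientation l r)"
    by (simp_all add: parcs_orientation)
  then have out: "(\<phi> v3, \<phi> v2) \<in> parcs (orientation l' r')" "(\<phi> v3, \<phi> v4) \<in> parcs (orientation l' r')"
    using E[of v3 v2] E[of v3 v4] by simp_all
  have "\<phi> v2 \<noteq> \<phi> v4" by (simp add: inj)
  \<comment> \<open>\<open>v3\<close> is the only vertex with two out-neighbours\<close>
  with out have mid: "\<phi> v3 = v3 \<and> (\<phi> v2 = v2 \<and> \<phi> v4 = v4 \<or> \<phi> v2 = v4 \<and> \<phi> v4 = v2)"
    unfolding parcs_orientation by (elim disjE conjE; simp)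
  \<comment> \<open>The image of an end vertex is adjacent to the image of its neighbour and differs
    from \<open>v3\<close>, so it is the end vertex on that side. Comparing the four end arcs then
    compares the flags.\<close>
  have ends: "\<phi> v1 \<noteq> \<phi> v3" "\<phi> v5 \<noteq> \<phi> v3"
    by (simp_all add: inj)
  have "(v1, v2) \<in> parcs (orientation l r) \<or> (v2, v1) \<in> parcs (orientation l r)"
    "(v5, v4) \<in> parcs (orientation l r) \<or> (v4, v5) \<in> parcs (orientation l r)"
    using flags by (auto simp: parcs_orientation flags_def)
  then have adj: "(\<phi> v1, \<phi> v2) \<in> parcs (orientation l' r') \<or> (\<phi> v2, \<phi> v1) \<in> parcs (orientation l' r')"
    "(\<phi> v5, \<phi> v4) \<in> parcs (orientation l' r') \<or> (\<phi> v4, \<phi> v5) \<in> parcs (orientation l' r')"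
    using E[of v1 v2] E[of v2 v1] E[of v4 v5] E[of v5 v4] by simp_all
  consider "\<phi> v2 = v2" "\<phi> v4 = v4" | "\<phi> v2 = v4" "\<phi> v4 = v2"
    using mid by blast
  then show ?thesis
  proof cases
    case 1
    with adj ends mid have "\<phi> v1 = v1" "\<phi> v5 = v5" by (simp_all add: parcs_orientation) blast+
    with 1 E[of v1 v2] E[of v2 v1] E[of v4 v5] E[of v5 v4] show ?thesis
      by (simp add: parcs_orientation prod_eq_iff)
  next
    case 2
    with adj ends mid have "\<phi> v1 = v5" "\<phi> v5 = v1" by (simp_all add: parcs_orientation) blast+
    with 2 E[of v1 v2] E[of v2 v1] E[of v4 v5] E[of v5 v4] show ?thesis
      by (simp add: parcs_orientation prod_eq_iff)
  qed
qed

lemma digraph_isomorphic_orientation_iff: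
  assumes "l \<in> flags" "r \<in> flags"
  shows "digraph_isomorphic (orientation l r) (orientation l' r') \<longleftrightarrow>
    l = l' \<and> r = r' \<or> l = r' \<and> r = l'"
  using digraph_isomorphic_orientation_cases[OF assms] digraph_isomorphic_orientation_swap
    digraph_isomorphic_refl by blast

section \<open>Counting the isomorphism classes\<close>

abbreviation S where "S \<equiv> {G :: 'a pair_pre_digraph. two_qBMG G \<and> underlying_graph G = P}"

abbreviation L where "L \<equiv> (\<lambda>E. \<lparr>pverts = V, parcs = E\<rparr>) `
  {{(v1, v2), (v3, v2), (v3, v4), (v4, v5)},
   {(v1, v2), (v3, v2), (v3, v4), (v5, v4)},
   {(v2, v1), (v3, v2), (v3, v4), (v4, v5)},
   {(v1, v2), (v2, v1), (v3, v2), (v3, v4), (v4, v5)},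
   {(v1, v2), (v2, v1), (v3, v2), (v3, v4), (v5, v4)},
   {(v1, v2), (v2, v1), (v3, v2), (v3, v4), (v4, v5), (v5, v4)}}"

lemma S_eq: "S = (\<lambda>(l, r). orientation l r) ` (flags \<times> flags)"
  using two_qBMG_orientation underlying_orientation
  by (auto elim!: two_qBMG_on_path_cases)

text \<open>One ordering of each unordered pair from \<open>flags\<close>, chosen to agree with the
  arc sets of \<open>L\<close>, in the same order.\<close>

definition unordered_flags :: "((bool \<times> bool) \<times> bool \<times> bool) set" where
  "unordered_flags =
    {((True, False), (False, True)), ((True, False), (True, False)), ((False, True), (False, True)),
     ((True, True), (False, True)), ((True, True), (True, False)), ((True, True), (True, True))}"

lemma unordered_flags_unique:
  assumes "l \<in> flags" "r \<in> flags"
  shows "\<exists>!k. k \<in> unordered_flags \<and> (k = (l, r) \<or> k = (r, l))"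
proof (rule ex1I)
  let ?k = "if (l, r) \<in> unordered_flags then (l, r) else (r, l)"
  show "?k \<in> unordered_flags \<and> (?k = (l, r) \<or> ?k = (r, l))"
    using assms by (auto simp: flags_def unordered_flags_def)
  show "k = ?k" if "k \<in> unordered_flags \<and> (k = (l, r) \<or> k = (r, l))" for k
    using that by (auto simp: unordered_flags_def)
qed

lemma L_eq: "L = (\<lambda>(l, r). orientation l r) ` unordered_flags"
  by (simp add: orientation_def unordered_flags_def insert_commute)

lemma card_L: "card L = 6"
  unfolding L_eq by (subst card_image) (auto simp: inj_on_def unordered_flags_def)

lemma L_subset_S: "L \<subseteq> S"
  unfolding L_eq S_eq by (rule image_mono) (auto simp: flags_def unordered_flags_def)

text \<open>Isomorphic orientations have the same flags up to a swap, so the claim reduces to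
  \<open>unordered_flags_unique\<close>.\<close>

lemma unique_representative:
  assumes "G \<in> S"
  shows "\<exists>!H. H \<in> L \<and> digraph_isomorphic G H"
proof -
  from assms obtain l r where "l \<in> flags" "r \<in> flags" "G = orientation l r"
    by (auto elim: two_qBMG_on_path_cases)
  then have iso: "digraph_isomorphic G (orientation l' r') \<longleftrightarrow> (l', r') = (l, r) \<or> (l', r') = (r, l)"
    for l' r'
    using digraph_isomorphic_orientation_iff[of l r l' r'] unfolding prod.inject by blast
  from unordered_flags_unique[OF \<open>l \<in> flags\<close> \<open>r \<in> flags\<close>]
  obtain k where k: "k \<in> unordered_flags" "k = (l, r) \<or> k = (r, l)"
    and unique: "\<And>k'. k' \<in> unordered_flags \<Longrightarrow> k' = (l, r) \<or> k' = (r, l) \<Longrightarrow> k' = k"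
    by (elim ex1E) blast
  obtain l' r' where "k = (l', r')" by (cases k)
  with k have rep: "(l', r') \<in> unordered_flags" "(l', r') = (l, r) \<or> (l', r') = (r, l)"
    by blast+
  show ?thesis
  proof (rule ex1I)
    show "orientation l' r' \<in> L \<and> digraph_isomorphic G (orientation l' r')"
      unfolding L_eq using rep iso by blast
    show "H = orientation l' r'" if "H \<in> L \<and> digraph_isomorphic G H" for H
    proof -
      from that obtain l'' r'' where "(l'', r'') \<in> unordered_flags" "H = orientation l'' r''"
        unfolding L_eq by auto
      with that unique[of "(l'', r'')"] iso[of l'' r''] \<open>k = (l', r')\<close> show ?thesis by simp
    qed
  qed
qed

lemma card_isomorphism_classes:
  "card (S // {(G, H). G \<in> S \<and> H \<in> S \<and> digraph_isomorphic G H}) = 6"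
  by (rule trans[OF card_isomorphism_classes_transversal[OF L_subset_S unique_representative] card_L])

end

theorem theorem3p2:
  fixes v1 v2 v3 v4 v5 :: 'a
  assumes "distinct [v1, v2, v3, v4, v5]"
  shows
    "(\<exists>G :: 'a pair_pre_digraph.
        two_qBMG G \<and> card (pverts G) = 5 \<and> \<not> P5_free (underlying_graph G)) \<and>
     (let V = {v1, v2, v3, v4, v5};
          P = (V, {{v1, v2}, {v2, v3}, {v3, v4}, {v4, v5}});
          S = {G :: 'a pair_pre_digraph. two_qBMG G \<and> underlying_graph G = P};
          L = (\<lambda>E. \<lparr>pverts = V, parcs = E\<rparr>) `
                {{(v1, v2), (v3, v2), (v3, v4), (v4, v5)},
                 {(v1, v2), (v3, v2), (v3, v4), (v5, v4)},
                 {(v2, v1), (v3, v2), (v3, v4), (v4, v5)},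
                 {(v1, v2), (v2, v1), (v3, v2), (v3, v4), (v4, v5)},
                 {(v1, v2), (v2, v1), (v3, v2), (v3, v4), (v5, v4)},
                 {(v1, v2), (v2, v1), (v3, v2), (v3, v4), (v4, v5), (v5, v4)}}
      in \<not> P5_free P \<and>
         card (S // {(G, H). G \<in> S \<and> H \<in> S \<and> digraph_isomorphic G H}) = 6 \<and>
         card L = 6 \<and> L \<subseteq> S \<and>
         (\<forall>G \<in> S. \<exists>!H \<in> L. digraph_isomorphic G H))"
proof -
  interpret five_path v1 v2 v3 v4 v5
    by unfold_locales (rule assms)
  \<comment> \<open>Any choice from \<open>flags\<close> would serve here, since the underlying
    graph is always \<open>P\<close>.\<close>
  let ?G = "orientation (True, False) (True, False)"
  have "card (pverts ?G) = 5"
    by simp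
  moreover have "\<not> P5_free (underlying_graph ?G)"
    using path_not_P5_free by (subst underlying_orientation) (simp_all add: flags_def)
  ultimately have "\<exists>G :: 'a pair_pre_digraph.
      two_qBMG G \<and> card (pverts G) = 5 \<and> \<not> P5_free (underlying_graph G)"
    using two_qBMG_orientation by blast
  then show ?thesis
    unfolding Let_def
    by (intro conjI ballI path_not_P5_free card_isomorphism_classes card_L L_subset_S
        unique_representative)
qed

end
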